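(* If a $q\times q$ symmetric integer matrix $Q$ is realizable, then $Q$ is a linear combination of basic $q\times q$ matrices with nonnegative integer coefficients.
   Context: A finite abstract simplicial complex is determined by its facets (inclusion-maximal faces), and its vertex set is the union of its facets. Given a complex with labeled facets $F_1,\dots,F_q$ and labeled vertices $1,\dots,n$, its facet-incidence matrix is the $q\times n$ matrix $B$ with $B_{ij}=1$ if $j\in F_i$ and $B_{ij}=0$ otherwise, and its facet-adjacency matrix is the $q\times q$ matrix $Q=BB^T$, so $Q_{ij}=|F_i\cap F_j|$. A $q\times q$ symmetric integer matrix is realizable if it is the facet-adjacency matrix of some simplicial complex with $q$ facets. A $q\times q$ matrix is basic if all of its entries are $0$ or $1$, it is symmetric, and it has rank $1$. *)

theory Defs
  imports "Jordan_Normal_Form.DL_Rank"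
begin

(* No face is required to exist: {} (no facets) and {{}} (one facet, no vertices) are both allowed. *)
definition simplicial_complex :: "'a set set \<Rightarrow> bool" where
  "simplicial_complex K \<longleftrightarrow>
     finite K \<and> (\<forall>F\<in>K. finite F) \<and> (\<forall>F\<in>K. \<forall>G. G \<subseteq> F \<longrightarrow> G \<in> K)"

definition facets :: "'a set set \<Rightarrow> 'a set set" where
  "facets K = {F \<in> K. \<forall>G\<in>K. F \<subseteq> G \<longrightarrow> G = F}"

definition vertices :: "'a set set \<Rightarrow> 'a set" where
  "vertices K = \<Union> (facets K)"

(* A labeling of a finite set by 1,...,m is a repetition-free list of its elements;
   the object with label i is the list entry at position i - 1. *)
definition labeling :: "'a list \<Rightarrow> 'a set \<Rightarrow> bool" where
  "labeling xs X \<longleftrightarrow> distinct xs \<and> set xs = X"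

definition facet_incidence_matrix :: "'a set list \<Rightarrow> 'a list \<Rightarrow> int mat" where
  "facet_incidence_matrix Fs vs =
     mat (length Fs) (length vs) (\<lambda>(i, j). if vs ! j \<in> Fs ! i then 1 else 0)"

definition facet_adjacency_matrix :: "'a set list \<Rightarrow> 'a list \<Rightarrow> int mat" where
  "facet_adjacency_matrix Fs vs =
     facet_incidence_matrix Fs vs * transpose_mat (facet_incidence_matrix Fs vs)"

lemma facet_adjacency_matrix_index:
  assumes "labeling Fs (facets K)" "labeling vs (vertices K)" "i < length Fs" "j < length Fs"
  shows "facet_adjacency_matrix Fs vs $$ (i, j) = int (card (Fs ! i \<inter> Fs ! j))"
proof -
  let ?P = "\<lambda>k. vs ! k \<in> Fs ! i \<inter> Fs ! j"
  have sub: "Fs ! i \<inter> Fs ! j \<subseteq> set vs"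
    using assms nth_mem[of i Fs] by (auto simp: labeling_def vertices_def)
  have "bij_betw ((!) vs) {k \<in> {0..<length vs}. ?P k} (Fs ! i \<inter> Fs ! j)"
  proof (rule bij_betw_imageI)
    show "inj_on ((!) vs) {k \<in> {0..<length vs}. ?P k}"
      using assms(2) by (auto simp: labeling_def inj_on_def nth_eq_iff_index_eq)
    show "(!) vs ` {k \<in> {0..<length vs}. ?P k} = Fs ! i \<inter> Fs ! j"
    proof
      show "Fs ! i \<inter> Fs ! j \<subseteq> (!) vs ` {k \<in> {0..<length vs}. ?P k}"
      proof
        fix x assume x: "x \<in> Fs ! i \<inter> Fs ! j"
        then obtain k where "k < length vs" "vs ! k = x"
          using sub by (meson in_set_conv_nth subsetD)
        then show "x \<in> (!) vs ` {k \<in> {0..<length vs}. ?P k}"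
          using x by (intro image_eqI[of _ _ k]) auto
      qed
    qed auto
  qed
  then have "card {k \<in> {0..<length vs}. ?P k} = card (Fs ! i \<inter> Fs ! j)"
    by (rule bij_betw_same_card)
  moreover have "facet_adjacency_matrix Fs vs $$ (i, j) =
      (\<Sum>k = 0..<length vs. if ?P k then 1 else 0)"
    using assms by (auto simp: facet_adjacency_matrix_def facet_incidence_matrix_def
        scalar_prod_def intro!: sum.cong)
  moreover have "\<dots> = int (card {k \<in> {0..<length vs}. ?P k})"
    by (simp add: sum.If_cases Int_def)
  ultimately show ?thesis by simp
qed

(* Every finite complex is isomorphic to one whose vertices are natural numbers,
   so nothing is lost by fixing the vertex type. *)
definition realizable :: "nat \<Rightarrow> int mat \<Rightarrow> bool" where
  "realizable q Q \<longleftrightarrow>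
     (\<exists>(K :: nat set set) Fs vs. simplicial_complex K \<and> labeling Fs (facets K) \<and>
        length Fs = q \<and> labeling vs (vertices K) \<and> Q = facet_adjacency_matrix Fs vs)"

(* The rank of an integer matrix is its rank over the rationals. *)
definition basic_matrix :: "nat \<Rightarrow> int mat \<Rightarrow> bool" where
  "basic_matrix q A \<longleftrightarrow>
     A \<in> carrier_mat q q \<and> (\<forall>i<q. \<forall>j<q. A $$ (i, j) \<in> {0, 1}) \<and>
     transpose_mat A = A \<and> vec_space.rank q (map_mat rat_of_int A) = 1"

end

theory Submission
  imports Defs
begin

text \<open>
  Let \<open>B\<close> be the facet-incidence matrix and \<open>b\<^sub>1, \<dots>, b\<^sub>n\<close> its columns, one for each vertex.
  Column-by-row expansion of the product gives
  \<open>B B\<^sup>T = b\<^sub>1 b\<^sub>1\<^sup>T + \<dots> + b\<^sub>n b\<^sub>n\<^sup>T\<close>. Each summand is a symmetric \<open>0/1\<close> matrix. It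
  has rank at most \<open>1\<close>, being an outer product, and rank at least \<open>1\<close>, because every
  vertex lies in some facet and so \<open>b\<^sub>k \<noteq> 0\<close> (\<open>basic_matrix_self_outer\<close>).

  Two vertices that lie in the same facets give the same summand. Collecting equal summands
  turns the sum over vertices into a linear combination of distinct basic matrices, in which the
  coefficient of a matrix is the number of vertices that produce it
  (\<open>sum_eq_multiplicity_finsum_mat\<close>).
\<close>

lemma (in vec_space) lin_indpt_singleton:
  assumes "v \<in> carrier_vec n" and "v \<noteq> 0\<^sub>v n"
  shows "lin_indpt {v}"
proof (rule finite_lin_indpt2)
  fix a :: "'a vec \<Rightarrow> 'a"
  assume lc: "lincomb a {v} = 0\<^sub>v n"
  obtain i where i: "i < n" "v $ i \<noteq> 0"
    using assms by (metis carrier_vecD eq_vecI index_zero_vec)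
  have "lincomb a {v} $ i = a v * v $ i"
    using lincomb_index[OF i(1), of "{v}" a] assms(1) by simp
  then have "a v * v $ i = 0"
    using lc i(1) by simp
  then show "\<forall>w\<in>{v}. a w = 0"
    using i(2) by simp
qed (use assms(1) in simp_all)

text \<open>
  Every column is a multiple of the vector of the values of \<open>f\<close>, so the rank is at most one; a
  nonzero entry lies in a nonzero column, which is by itself linearly independent.
\<close>
lemma (in vec_space) rank_product_entries_eq_1:
  fixes f g :: "nat \<Rightarrow> 'a"
  assumes "r < n" "c < nc" "f r \<noteq> 0" "g c \<noteq> 0"
  shows "rank (mat n nc (\<lambda>(i, j). f i * g j)) = 1"
proof (rule antisym)
  let ?A = "mat n nc (\<lambda>(i, j). f i * g j)"
  show "rank ?A \<le> 1"
    by (rule rank_le_1_product_entries[of _ nc f g]) auto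
  have "col ?A c $ r \<noteq> 0"
    using assms by simp
  then have "col ?A c \<noteq> 0\<^sub>v n"
    using assms(1) by auto
  moreover have "col ?A c \<in> carrier_vec n"
    by (rule carrier_vecI) simp
  ultimately have "lin_indpt {col ?A c}"
    by (rule lin_indpt_singleton[rotated])
  moreover have "{col ?A c} \<subseteq> set (cols ?A)"
    using assms(2) by (auto simp: cols_def)
  ultimately show "1 \<le> rank ?A"
    using rank_ge_card_indpt[of ?A nc "{col ?A c}"] by simp
qed

lemma basic_matrix_self_outer:
  fixes b :: "nat \<Rightarrow> int"
  assumes "\<And>i. i < q \<Longrightarrow> b i \<in> {0, 1}" and "r < q" "b r \<noteq> 0"
  shows "basic_matrix q (mat q q (\<lambda>(i, j). b i * b j))"
proof -
  have "map_mat rat_of_int (mat q q (\<lambda>(i, j). b i * b j)) =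
      mat q q (\<lambda>(i, j). rat_of_int (b i) * rat_of_int (b j))"
    by (rule eq_matI) auto
  then have "vec_space.rank q (map_mat rat_of_int (mat q q (\<lambda>(i, j). b i * b j))) = 1"
    using assms(2,3) by (simp add: vec_space.rank_product_entries_eq_1[of r q r])
  moreover have "b i * b j \<in> {0, 1}" if "i < q" "j < q" for i j
    using assms(1)[OF that(1)] assms(1)[OF that(2)] by auto
  moreover have "transpose_mat (mat q q (\<lambda>(i, j). b i * b j)) = mat q q (\<lambda>(i, j). b i * b j)"
    by (rule eq_matI) (auto simp: mult.commute)
  ultimately show ?thesis
    unfolding basic_matrix_def by simp
qed

lemma index_finsum_mat:
  fixes M :: "'b \<Rightarrow> 'a :: comm_ring_1 mat"
  assumes "finite S" and "\<And>x. x \<in> S \<Longrightarrow> M x \<in> carrier_mat nr nc" and "i < nr" "j < nc"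
  shows "finsum (module_mat TYPE('a) nr nc) M S $$ (i, j) = (\<Sum>x\<in>S. M x $$ (i, j))"
proof -
  interpret abelian_group "module_mat TYPE('a) nr nc"
    by (rule abelian_group_mat)
  from assms(1,2) show ?thesis
  proof (induction S rule: finite_induct)
    case empty
    show ?case
      using assms(3,4) by (simp add: finsum_empty module_mat_simps)
  next
    case (insert x S)
    have "finsum (module_mat TYPE('a) nr nc) M S \<in> carrier_mat nr nc"
      using insert.prems by (intro finsum_closed[unfolded module_mat_simps]) auto
    moreover have "finsum (module_mat TYPE('a) nr nc) M (insert x S) =
        M x + finsum (module_mat TYPE('a) nr nc) M S"
      using insert.hyps insert.prems by (subst finsum_insert) (auto simp: module_mat_simps)
    ultimately show ?case
      using insert assms(3,4) by simp
  qed
qed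

text \<open>
  The family \<open>M\<close> may repeat a matrix, whereas a linear combination over a set names each
  matrix once. Grouping the entrywise sum by the value of \<open>M k\<close> turns repetitions into
  coefficients.
\<close>
lemma sum_eq_multiplicity_finsum_mat:
  fixes M :: "'b \<Rightarrow> 'a :: comm_ring_1 mat"
  assumes "finite I" and M: "\<And>k. k \<in> I \<Longrightarrow> M k \<in> carrier_mat nr nc"
    and Q: "Q \<in> carrier_mat nr nc"
    and sum: "\<And>i j. i < nr \<Longrightarrow> j < nc \<Longrightarrow> Q $$ (i, j) = (\<Sum>k\<in>I. M k $$ (i, j))"
  shows "Q = finsum (module_mat TYPE('a) nr nc)
    (\<lambda>A. of_nat (card {k \<in> I. M k = A}) \<cdot>\<^sub>m A) (M ` I)" (is "Q = ?R")
proof -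
  interpret abelian_group "module_mat TYPE('a) nr nc"
    by (rule abelian_group_mat)
  have R: "?R \<in> carrier_mat nr nc"
    using M by (intro finsum_closed[unfolded module_mat_simps]) auto
  show ?thesis
  proof (rule eq_matI)
    fix i j assume "i < dim_row ?R" "j < dim_col ?R"
    then have ij: "i < nr" "j < nc"
      using R by auto
    have "Q $$ (i, j) = (\<Sum>A\<in>M ` I. \<Sum>k\<in>{k \<in> I. M k = A}. M k $$ (i, j))"
      unfolding sum[OF ij] by (rule sum.image_gen[OF \<open>finite I\<close>])
    also have "\<dots> = (\<Sum>A\<in>M ` I. of_nat (card {k \<in> I. M k = A}) * A $$ (i, j))"
      by (rule sum.cong) auto
    also have "\<dots> = (\<Sum>A\<in>M ` I. (of_nat (card {k \<in> I. M k = A}) \<cdot>\<^sub>m A) $$ (i, j))"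
      using M ij by (intro sum.cong) (fastforce dest: carrier_matD)+
    also have "\<dots> = ?R $$ (i, j)"
      using \<open>finite I\<close> M ij by (subst index_finsum_mat) auto
    finally show "Q $$ (i, j) = ?R $$ (i, j)" .
  qed (use Q R in auto)
qed

theorem proposition2p2:
  fixes q :: nat and Q :: "int mat"
  assumes "Q \<in> carrier_mat q q"
    and "transpose_mat Q = Q"
    and "realizable q Q"
  shows "\<exists>S (c :: int mat \<Rightarrow> nat). finite S \<and> (\<forall>A\<in>S. basic_matrix q A) \<and>
    Q = finsum (module_mat TYPE(int) q q) (\<lambda>A. int (c A) \<cdot>\<^sub>m A) S"
proof -
  obtain K :: "nat set set" and Fs vs where
    Fs: "labeling Fs (facets K)" "length Fs = q" and
    vs: "labeling vs (vertices K)" and Q: "Q = facet_adjacency_matrix Fs vs"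
    using assms(3) unfolding realizable_def by blast
  define b :: "nat \<Rightarrow> nat \<Rightarrow> int" where "b k i = (if vs ! k \<in> Fs ! i then 1 else 0)" for k i
  define M where "M k = mat q q (\<lambda>(i, j). b k i * b k j)" for k
  have "basic_matrix q (M k)" if "k < length vs" for k
  proof -
    have "vs ! k \<in> \<Union> (set Fs)"
      using that vs Fs(1) nth_mem[of k vs] by (auto simp: labeling_def vertices_def)
    then obtain r where "r < q" "vs ! k \<in> Fs ! r"
      using Fs(2) by (auto simp: in_set_conv_nth)
    then show ?thesis
      unfolding M_def by (intro basic_matrix_self_outer[of q "b k" r]) (auto simp: b_def)
  qed
  moreover have "Q $$ (i, j) = (\<Sum>k\<in>{0..<length vs}. M k $$ (i, j))" if "i < q" "j < q" for i j
    using that Fs(2)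
    by (auto simp: Q facet_adjacency_matrix_def facet_incidence_matrix_def scalar_prod_def
        M_def b_def intro!: sum.cong)
  then have "Q = finsum (module_mat TYPE(int) q q)
      (\<lambda>A. int (card {k \<in> {0..<length vs}. M k = A}) \<cdot>\<^sub>m A) (M ` {0..<length vs})"
    by (intro sum_eq_multiplicity_finsum_mat assms(1)) (auto simp: M_def)
  ultimately show ?thesis
    by (intro exI[of _ "M ` {0..<length vs}"]
        exI[of _ "\<lambda>A. card {k \<in> {0..<length vs}. M k = A}"]) auto
qed

end
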